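(* Fix $0<\rho<1$, let $p(w)=w-\rho$, $q(w)=1-\rho w$, let $h(w)=(1-\rho w^{-1})(1-\rho w)=1+\rho^2-\rho w-\rho w^{-1}$, let $$B(w)=\frac{1}{\sqrt2\,w}\begin{pmatrix}0&0&0&p(w)^2\\ q(w)^2&0&p(w)^2&0\\ 0&0&0&-q(w)^2\\ 0&0&0&0\end{pmatrix},$$ and, for $|z|=1=|w|$, let $$P(z,w)=h(w)I_4+zB(w)+z^{-1}B(w)^*.$$ Then $P(z,w)=G(z,w)^*G(z,w)$ for all $|z|=1=|w|$, where $G$ is the $2\times4$ matrix-valued analytic polynomial with $\deg_z G=2$ given (with $p=p(w)$, $q=q(w)$) by $$G(z,w)=\begin{pmatrix}\dfrac{qz}{\sqrt2}&\dfrac{p+q}{2}&\dfrac{pz}{\sqrt2}&\dfrac{p-q}{2}z^2\\[3mm] \dfrac{qz}{\sqrt2}&\dfrac{p-q}{2}&-\dfrac{pz}{\sqrt2}&\dfrac{p+q}{2}z^2\end{pmatrix}.$$ In particular, $P(z,w)\succeq0$ for all $|z|=1=|w|$. Further, if $n$ is a positive integer and $F$ is an $n\times4$ matrix-valued analytic polynomial such that $P(z,w)=F(z,w)^*F(z,w)$ for all $|z|=1=|w|$, then $\deg_z F\ge2$.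
   Context: An analytic matrix-valued polynomial is a polynomial in $z,w$ (nonnegative powers only) with complex matrix coefficients; $\deg_z$ denotes its degree in the variable $z$. $^*$ denotes the conjugate transpose of a complex matrix, and $\succeq0$ means Hermitian positive semidefinite. *)

theory Defs
  imports "HOL-Analysis.Analysis" "HOL-Computational_Algebra.Polynomial"
begin

definition ctranspose :: "complex^'m^'n \<Rightarrow> complex^'n^'m" where
  "ctranspose A = map_matrix cnj (transpose A)"

abbreviation cscale :: "complex \<Rightarrow> complex^'m^'n \<Rightarrow> complex^'m^'n" where
  "cscale c A \<equiv> map_matrix ((*) c) A"

definition psd :: "complex^'n^'n \<Rightarrow> bool" where
  "psd A \<longleftrightarrow> ctranspose A = A \<and>
     (\<forall>x. 0 \<le> Re (\<Sum>i\<in>UNIV. cnj (x $ i) * (A *v x) $ i))"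

(* Polynomials in z whose coefficients are polynomials in w with matrix coefficients:
   coeff (coeff F i) j is the coefficient of z^i w^j. *)
type_synonym ('m, 'n) matrix_poly2 = "(complex^'m^'n) poly poly"

definition eval2 :: "('m::finite, 'n::finite) matrix_poly2 \<Rightarrow> complex \<Rightarrow> complex \<Rightarrow> complex^'m^'n" where
  "eval2 F z w =
     (\<Sum>i\<le>degree F. \<Sum>j\<le>degree (coeff F i). cscale (z ^ i * w ^ j) (coeff (coeff F i) j))"

(* z is the outer variable; the zero polynomial gets degree 0. *)
abbreviation deg_z :: "('m::finite, 'n::finite) matrix_poly2 \<Rightarrow> nat" where
  "deg_z F \<equiv> degree F"

definition p_fun :: "real \<Rightarrow> complex \<Rightarrow> complex" where
  "p_fun \<rho> w = w - of_real \<rho>"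

definition q_fun :: "real \<Rightarrow> complex \<Rightarrow> complex" where
  "q_fun \<rho> w = 1 - of_real \<rho> * w"

definition h_fun :: "real \<Rightarrow> complex \<Rightarrow> complex" where
  "h_fun \<rho> w = (1 - of_real \<rho> * inverse w) * (1 - of_real \<rho> * w)"

lemma h_fun_expand:
  assumes "w \<noteq> 0"
  shows "h_fun \<rho> w = 1 + (of_real \<rho>)\<^sup>2 - of_real \<rho> * w - of_real \<rho> * inverse w"
  using assms by (simp add: h_fun_def field_simps power2_eq_square)

definition B_mat :: "real \<Rightarrow> complex \<Rightarrow> complex^4^4" where
  "B_mat \<rho> w = (let p = p_fun \<rho> w; q = q_fun \<rho> w in
     cscale (1 / (of_real (sqrt 2) * w))
       (vector [vector [0,   0, 0,   p^2],
                vector [q^2, 0, p^2, 0],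
                vector [0,   0, 0,   - (q^2)],
                vector [0,   0, 0,   0]]))"

definition P_mat :: "real \<Rightarrow> complex \<Rightarrow> complex \<Rightarrow> complex^4^4" where
  "P_mat \<rho> z w =
     cscale (h_fun \<rho> w) (mat 1) + cscale z (B_mat \<rho> w) + cscale (inverse z) (ctranspose (B_mat \<rho> w))"

definition G_mat :: "real \<Rightarrow> complex \<Rightarrow> complex \<Rightarrow> complex^4^2" where
  "G_mat \<rho> z w = (let p = p_fun \<rho> w; q = q_fun \<rho> w; s = of_real (sqrt 2) in
     vector [vector [q * z / s, (p + q) / 2, p * z / s,     (p - q) / 2 * z^2],
             vector [q * z / s, (p - q) / 2, - (p * z / s), (p + q) / 2 * z^2]])"

end

theory Submission
  imports Defs "HOL-Computational_Algebra.Field_as_Ring"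
    "HOL-Computational_Algebra.Polynomial_Factorial"
begin

text \<open>
  On the unit circle \<open>cnj p = q / w\<close>, \<open>cnj q = p / w\<close> and \<open>h = \<bar>p\<bar>\<^sup>2 = \<bar>q\<bar>\<^sup>2 = p q / w\<close>, so
  \<open>P = G\<^sup>* G\<close> is a computation with sixteen entries, and a Gram matrix is positive semidefinite.

  The lower bound on the degree goes as follows. Suppose \<open>F(z,w) = F\<^sub>0(w) + z F\<^sub>1(w)\<close>, and let \<open>a\<^sub>i\<close>
  and \<open>b\<^sub>i\<close> be the columns of \<open>F\<^sub>0(w)\<close> and \<open>F\<^sub>1(w)\<close>. Comparing the coefficients of \<open>z\<close> in
  \<open>P = F\<^sup>* F\<close> gives, for \<open>\<bar>w\<bar> = 1\<close>,
  \<open>\<langle>a\<^sub>i, a\<^sub>j\<rangle> + \<langle>b\<^sub>i, b\<^sub>j\<rangle> = h \<delta>\<^sub>i\<^sub>j\<close> and \<open>\<langle>a\<^sub>i, b\<^sub>j\<rangle> = B\<^sub>i\<^sub>j\<close>.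
  The nonzero entries of \<open>B\<close> all have modulus \<open>h / \<surd>2\<close>, and they pair the single vector \<open>a\<^sub>2\<close> with
  both \<open>b\<^sub>1\<close> and \<open>b\<^sub>3\<close>, and the single vector \<open>b\<^sub>4\<close> with both \<open>a\<^sub>1\<close> and \<open>a\<^sub>3\<close>. This is as much
  as the Cauchy--Schwarz inequality allows: a combination of columns 1 and 3 that is aligned with
  \<open>a\<^sub>2\<close> must have all its length in \<open>F\<^sub>1\<close>, and one that is aligned with \<open>b\<^sub>4\<close> must have all its
  length in \<open>F\<^sub>0\<close>. Hence (\<open>column_relations\<close>)
  \<open>p\<^sup>2 a\<^sub>1 + q\<^sup>2 a\<^sub>3 = 0\<close> and \<open>p\<^sup>2 b\<^sub>1 - q\<^sup>2 b\<^sub>3 = 0\<close>.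

  These are identities of polynomials in \<open>w\<close>, and \<open>p\<close> and \<open>q\<close> are coprime because \<open>\<rho>\<^sup>2 \<noteq> 1\<close>.
  Therefore \<open>q\<^sup>2\<close> divides every entry of \<open>a\<^sub>1\<close> and of \<open>b\<^sub>1\<close>. After multiplication by a power of
  \<open>w\<close> that clears the conjugates, \<open>\<parallel>a\<^sub>1\<parallel>\<^sup>2 + \<parallel>b\<^sub>1\<parallel>\<^sup>2 = h = p q / w\<close> becomes a polynomial identity
  whose left side is divisible by \<open>q\<^sup>2\<close> (\<open>dvd_sum_of_squares_unit_circle\<close>). But \<open>w\<^sup>N p q\<close> has only
  a simple zero at \<open>1 / \<rho>\<close>, a contradiction.
\<close>

section \<open>Entries of matrix polynomials\<close>

lemma poly_sum_degree_le:
  fixes p :: "'a::comm_ring_1 poly"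
  assumes "degree p \<le> n"
  shows "poly p x = (\<Sum>i\<le>n. coeff p i * x ^ i)"
  unfolding poly_altdef
  using assms by (intro sum.mono_neutral_left) (auto simp: coeff_eq_0)

text \<open>The outer variable is still \<open>z\<close>, so that \<open>coeff (entry_poly F k l) i\<close> is the
  polynomial in \<open>w\<close> that multiplies \<open>z ^ i\<close>.\<close>
definition entry_poly :: "('m::finite, 'n::finite) matrix_poly2 \<Rightarrow> 'n \<Rightarrow> 'm \<Rightarrow> complex poly poly" where
  "entry_poly F k l = map_poly (map_poly (\<lambda>M. M $ k $ l)) F"

lemma degree_entry_poly_le: "degree (entry_poly F k l) \<le> degree F"
  unfolding entry_poly_def by (rule map_poly_degree_leq)

lemma eval2_entry:
  "eval2 F z w $ k $ l = poly (poly (entry_poly F k l) [:z:]) w"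
proof -
  have inner: "poly (coeff (entry_poly F k l) i) w
      = (\<Sum>j\<le>degree (coeff F i). coeff (coeff F i) j $ k $ l * w ^ j)" for i
    by (subst poly_sum_degree_le[where n = "degree (coeff F i)"])
       (auto simp: entry_poly_def coeff_map_poly map_poly_degree_leq)
  have "poly (poly (entry_poly F k l) [:z:]) w
      = (\<Sum>i\<le>degree F. poly (coeff (entry_poly F k l) i) w * z ^ i)"
    by (simp add: poly_sum_degree_le[OF degree_entry_poly_le] poly_sum)
  also have "\<dots> = eval2 F z w $ k $ l"
    by (simp add: inner eval2_def map_matrix_def sum_distrib_left sum_distrib_right mult_ac)
  finally show ?thesis ..
qed

lemma vector_4:
  fixes a b c d :: "'a::zero"
  shows "(vector [a, b, c, d] :: 'a^4) $ 1 = a" "(vector [a, b, c, d] :: 'a^4) $ 2 = b"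
    "(vector [a, b, c, d] :: 'a^4) $ 3 = c" "(vector [a, b, c, d] :: 'a^4) $ 4 = d"
  by (simp_all add: vector_def)

section \<open>Gram matrices\<close>

lemma ctranspose_mult_entry:
  "(ctranspose A ** B) $ i $ j = (\<Sum>k\<in>UNIV. cnj (A $ k $ i) * B $ k $ j)"
  by (simp add: matrix_matrix_mult_def ctranspose_def map_matrix_def transpose_def)

text \<open>The quadratic form of \<open>A\<^sup>* A\<close> at \<open>x\<close> is the squared length of \<open>A x\<close>.\<close>
lemma psd_gram: "psd (ctranspose A ** A)"
  unfolding psd_def
proof (intro conjI allI)
  show "ctranspose (ctranspose A ** A) = ctranspose A ** A"
    by (simp add: vec_eq_iff ctranspose_mult_entry)
       (simp add: ctranspose_def map_matrix_def transpose_def matrix_matrix_mult_def mult.commute)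
next
  fix x
  have "(\<Sum>i\<in>UNIV. cnj (x $ i) * ((ctranspose A ** A) *v x) $ i)
      = (\<Sum>i\<in>UNIV. \<Sum>k\<in>UNIV. cnj (A $ k $ i * x $ i) * (A *v x) $ k)"
    by (simp only: matrix_vector_mul_assoc[symmetric])
       (simp add: matrix_vector_mult_def ctranspose_def map_matrix_def transpose_def
          sum_distrib_left mult_ac)
  also have "\<dots> = (\<Sum>k\<in>UNIV. cnj ((A *v x) $ k) * (A *v x) $ k)"
    by (subst sum.swap) (simp add: matrix_vector_mult_def sum_distrib_right)
  finally show "0 \<le> Re (\<Sum>i\<in>UNIV. cnj (x $ i) * ((ctranspose A ** A) *v x) $ i)"
    by (simp add: sum_nonneg)
qed

section \<open>The factorization of degree two\<close>

lemma P_mat_entry: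
  "P_mat \<rho> z w $ i $ j = (if i = j then h_fun \<rho> w else 0)
     + z * B_mat \<rho> w $ i $ j + inverse z * cnj (B_mat \<rho> w $ j $ i)"
  by (simp add: P_mat_def ctranspose_def map_matrix_def transpose_def mat_def)

lemma B_mat_entry:
  "B_mat \<rho> w $ i $ j =
    (if i = 1 \<and> j = 4 \<or> i = 2 \<and> j = 3 then (p_fun \<rho> w)\<^sup>2
     else if i = 2 \<and> j = 1 then (q_fun \<rho> w)\<^sup>2
     else if i = 3 \<and> j = 4 then - (q_fun \<rho> w)\<^sup>2 else 0) / (of_real (sqrt 2) * w)"
  using exhaust_4[of i] exhaust_4[of j]
  by (auto simp: B_mat_def Let_def map_matrix_def vector_4)

lemma cnj_unit: "norm w = 1 \<Longrightarrow> cnj w = inverse w"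
  by (simp add: divide_conv_cnj inverse_eq_divide)

text \<open>Conjugation on the unit circle swaps \<open>p\<close> and \<open>q\<close> up to the factor \<open>1 / w\<close>. Thus \<open>P\<close> can be
  rewritten as a rational expression in \<open>z\<close>, \<open>w\<close>, \<open>p\<close> and \<open>q\<close> without any conjugates.\<close>
lemma unit_circle_p_q:
  assumes "norm w = 1"
  shows "cnj (p_fun \<rho> w) = q_fun \<rho> w / w" "cnj (q_fun \<rho> w) = p_fun \<rho> w / w"
    "h_fun \<rho> w = p_fun \<rho> w * q_fun \<rho> w / w"
proof -
  have "w \<noteq> 0" using assms by auto
  then show "cnj (p_fun \<rho> w) = q_fun \<rho> w / w" "cnj (q_fun \<rho> w) = p_fun \<rho> w / w"
    "h_fun \<rho> w = p_fun \<rho> w * q_fun \<rho> w / w"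
    using assms by (simp_all add: p_fun_def q_fun_def h_fun_def cnj_unit field_simps)
qed

lemma P_mat_eq_gram_G_mat:
  assumes "norm z = 1" "norm w = 1"
  shows "P_mat \<rho> z w = ctranspose (G_mat \<rho> z w) ** G_mat \<rho> z w"
proof -
  define s :: complex where "s = of_real (sqrt 2)"
  have s: "s * s = 2" "cnj s = s" "s \<noteq> 0"
    by (simp_all add: s_def flip: of_real_mult)
  have nz: "z \<noteq> 0" "w \<noteq> 0" using assms by auto
  show ?thesis
    unfolding vec_eq_iff forall_4 ctranspose_mult_entry sum_2 P_mat_entry B_mat_entry G_mat_def
      Let_def vector_2 vector_4 s_def[symmetric]
    by (simp add: unit_circle_p_q[OF assms(2)] cnj_unit assms s nz)
      (simp add: field_simps power2_eq_square s nz)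
qed

text \<open>The coefficients \<open>\<plusminus> a\<close>, \<open>\<plusminus> b\<close> come from
  \<open>(p + q) / 2 = a + a w\<close> and \<open>(p - q) / 2 = - b + b w\<close>.\<close>
definition G_poly :: "real \<Rightarrow> (4, 2) matrix_poly2" where
  "G_poly \<rho> = (let r = of_real \<rho>; s = of_real (sqrt 2); a = (1 - r) / 2; b = (1 + r) / 2 in
     [: [: vector [vector [0, a, 0, 0], vector [0, - b, 0, 0]],
           vector [vector [0, a, 0, 0], vector [0, b, 0, 0]] :],
        [: vector [vector [1 / s, 0, - (r / s), 0], vector [1 / s, 0, r / s, 0]],
           vector [vector [- (r / s), 0, 1 / s, 0], vector [- (r / s), 0, - (1 / s), 0]] :],
        [: vector [vector [0, 0, 0, - b], vector [0, 0, 0, a]],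
           vector [vector [0, 0, 0, b], vector [0, 0, 0, a]] :] :])"

lemma eval2_G_poly: "eval2 (G_poly \<rho>) z w = G_mat \<rho> z w"
  unfolding vec_eq_iff forall_4 forall_2 eval2_entry
  by (simp add: G_poly_def Let_def entry_poly_def map_poly_pCons vector_4 G_mat_def p_fun_def q_fun_def)
    (simp add: field_simps power2_eq_square)

lemma deg_G_poly:
  assumes "\<rho> < 1"
  shows "deg_z (G_poly \<rho>) = 2"
proof -
  (* M is the leading coefficient, at z^2 w; its entry in position (2,4) vanishes only for rho = 1. *)
  define M :: "complex^4^2" where "M = vector [vector [0, 0, 0, of_real ((1 + \<rho>) / 2)],
             vector [0, 0, 0, of_real ((1 - \<rho>) / 2)]]"
  have "M $ 2 $ 4 \<noteq> 0" using assms by (simp add: M_def vector_4)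
  then have "M \<noteq> 0" by (metis zero_index)
  then show ?thesis by (simp add: G_poly_def Let_def M_def)
qed

section \<open>Polynomial identities on the unit circle\<close>

text \<open>The roots \<open>\<rho>\<close> and \<open>1 / \<rho>\<close> differ; explicitly, \<open>\<rho> p + q = 1 - \<rho>\<^sup>2\<close> is a nonzero constant.\<close>
lemma coprime_p_q:
  assumes "0 < \<rho>" "\<rho> < 1"
  shows "coprime ([:- of_real \<rho>, 1:] ^ 2) ([:1, - of_real \<rho>:] ^ 2 :: complex poly)"
proof -
  have nz: "(1 - of_real (\<rho>\<^sup>2)::complex) \<noteq> 0" using assms
    by (metis abs_square_eq_1 abs_of_pos eq_iff_diff_eq_0 of_real_1 of_real_eq_iff order_less_irrefl)
  have "coprime [:- of_real \<rho>, 1:] ([:1, - of_real \<rho>:] :: complex poly)"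
  proof (rule coprimeI)
    fix c :: "complex poly"
    assume "c dvd [:- of_real \<rho>, 1:]" "c dvd [:1, - of_real \<rho>:]"
    then have "c dvd smult (of_real \<rho>) [:- of_real \<rho>, 1:] + [:1, - of_real \<rho>:]"
      by (intro dvd_add dvd_smult)
    also have "smult (of_real \<rho>) [:- of_real \<rho>, 1:] + [:1, - of_real \<rho>:]
        = [:1 - of_real (\<rho>\<^sup>2) :: complex:]"
      by (simp add: power2_eq_square)
    also have "\<dots> dvd 1"
      using nz by (simp add: is_unit_const_poly_iff dvd_field_iff)
    finally show "is_unit c" .
  qed
  then show ?thesis by simp
qed

lemma poly_eqI_unit_circle:
  fixes p q :: "complex poly"
  assumes "\<And>w. norm w = 1 \<Longrightarrow> poly p w = poly q w"
  shows "p = q"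
proof (rule ccontr)
  assume "p \<noteq> q"
  then have fin: "finite {w. poly (p - q) w = 0}"
    by (intro poly_roots_finite) simp
  have "sphere (0::complex) 1 \<subseteq> {w. poly (p - q) w = 0}"
    using assms by auto
  then have "finite (sphere (0::complex) 1)"
    using fin finite_subset by blast
  then obtain c where "sphere (0::complex) 1 \<subseteq> {c}"
    using connected_finite_iff_sing[of "sphere (0::complex) 1"] connected_sphere[of "0::complex" 1]
    by auto
  moreover have "1 \<in> sphere (0::complex) 1" "- 1 \<in> sphere (0::complex) 1" by simp_all
  ultimately have "(1::complex) = - 1" by blast
  then show False by simp
qed

text \<open>On the circle \<open>cnj w = 1 / w\<close>, so the conjugate of a polynomial is a polynomial in \<open>1 / w\<close>,
  and \<open>w ^ N\<close> clears its denominators.\<close>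
lemma conjugate_poly_unit_circle:
  assumes "degree A \<le> N"
  obtains A' where "\<And>w. norm w = 1 \<Longrightarrow> w ^ N * cnj (poly A w) = poly A' w"
proof
  fix w :: complex assume w: "norm w = 1"
  then have nz: "w \<noteq> 0" by auto
  have "w ^ N * cnj (poly A w) = (\<Sum>i\<le>N. w ^ N * (cnj (coeff A i) * inverse w ^ i))"
    by (simp add: poly_sum_degree_le[OF assms] cnj_unit[OF w] sum_distrib_left)
  also have "\<dots> = (\<Sum>i\<le>N. cnj (coeff A i) * w ^ (N - i))"
    by (intro sum.cong) (auto simp: nz power_diff field_simps)
  finally show "w ^ N * cnj (poly A w) = poly (\<Sum>i\<le>N. monom (cnj (coeff A i)) (N - i)) w"
    by (simp add: poly_sum poly_monom)
qed

text \<open>A sum of squared moduli is not itself analytic, but its restriction to the circle is a Laurent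
  polynomial \<open>L(w) / w\<close>, and each of its terms contains one factor \<open>A s\<close> that is not conjugated. A
  common divisor of the \<open>A s\<close> therefore divides \<open>L\<close>, up to a power of \<open>w\<close>.\<close>
lemma dvd_sum_of_squares_unit_circle:
  assumes fin: "finite S"
    and dvd: "\<And>s. s \<in> S \<Longrightarrow> d dvd A s"
    and L: "\<And>w. norm w = 1 \<Longrightarrow> w * (\<Sum>s\<in>S. cnj (poly (A s) w) * poly (A s) w) = poly L w"
  obtains N where "d dvd monom 1 N * L"
proof -
  obtain N where N: "\<And>s. s \<in> S \<Longrightarrow> degree (A s) \<le> N"
    using fin by (metis finite_imageI finite_nat_set_iff_bounded_le imageI)
  have "\<exists>A'. \<forall>w. norm w = 1 \<longrightarrow> w ^ N * cnj (poly (A s) w) = poly A' w" if "s \<in> S" for s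
    using conjugate_poly_unit_circle[OF N[OF that]] by metis
  then obtain A' where
    A': "\<And>s w. s \<in> S \<Longrightarrow> norm w = 1 \<Longrightarrow> w ^ N * cnj (poly (A s) w) = poly (A' s) w"
    by metis
  have "monom 1 N * L = monom 1 1 * (\<Sum>s\<in>S. A' s * A s)"
  proof (rule poly_eqI_unit_circle)
    fix w :: complex assume w: "norm w = 1"
    have "poly (monom 1 N * L) w = w * (\<Sum>s\<in>S. (w ^ N * cnj (poly (A s) w)) * poly (A s) w)"
      by (simp add: poly_monom L[OF w, symmetric] sum_distrib_left mult_ac)
    also have "\<dots> = poly (monom 1 1 * (\<Sum>s\<in>S. A' s * A s)) w"
      by (simp add: poly_monom poly_sum A' w)
    finally show "poly (monom 1 N * L) w = poly (monom 1 1 * (\<Sum>s\<in>S. A' s * A s)) w" .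
  qed
  moreover have "d dvd monom 1 1 * (\<Sum>s\<in>S. A' s * A s)"
    using dvd by (intro dvd_mult dvd_sum) auto
  ultimately show thesis using that by metis
qed

section \<open>The Hermitian inner product and the Cauchy--Schwarz inequality\<close>

text \<open>The inner product of the class \<open>real_inner\<close> on \<open>complex^'n\<close> is only the real part of this one.\<close>
definition hinner :: "complex^'n \<Rightarrow> complex^'n \<Rightarrow> complex" where
  "hinner x y = (\<Sum>k\<in>UNIV. cnj (x $ k) * y $ k)"

lemma hinner_simps:
  "hinner (x + y) z = hinner x z + hinner y z"
  "hinner x (y + z) = hinner x y + hinner x z"
  "hinner (c *s x) y = cnj c * hinner x y"
  "hinner x (c *s y) = c * hinner x y"
  by (simp_all add: hinner_def sum.distrib sum_distrib_left algebra_simps)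

lemma hinner_commute: "hinner y x = cnj (hinner x y)"
  by (simp add: hinner_def mult.commute)

lemma hinner_self: "hinner x x = of_real ((norm x)\<^sup>2)"
  by (simp add: hinner_def norm_vec_def L2_set_def sum_nonneg mult.commute
      flip: complex_norm_square)

lemma norm_hinner_le: "norm (hinner x y) \<le> norm x * norm y"
proof -
  have "norm (hinner x y) \<le> (\<Sum>k\<in>UNIV. \<bar>norm (x $ k)\<bar> * \<bar>norm (y $ k)\<bar>)"
    unfolding hinner_def by (rule order_trans[OF norm_sum]) (simp add: norm_mult)
  also have "\<dots> \<le> norm x * norm y"
    unfolding norm_vec_def by (rule L2_set_mult_ineq)
  finally show ?thesis .
qed

text \<open>The pair \<open>(x, y)\<close> has squared length at most \<open>t\<close>. If the inner product of \<open>y\<close> with \<open>u\<close> is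
  as large as the Cauchy--Schwarz inequality would allow for a vector \<open>y\<close> of squared length \<open>t\<close>,
  then \<open>y\<close> uses up the whole length and nothing is left for \<open>x\<close>.\<close>
lemma zero_if_cauchy_schwarz_saturated:
  assumes "(norm x)\<^sup>2 + (norm y)\<^sup>2 \<le> t" "(norm u)\<^sup>2 \<le> s" "0 < s"
    and "(norm (hinner u y))\<^sup>2 = s * t"
  shows "x = 0"
proof -
  have "s * t \<le> (norm u * norm y)\<^sup>2"
    using power_mono[OF norm_hinner_le, of u y 2] assms(4) by simp
  also have "\<dots> \<le> s * (norm y)\<^sup>2"
    using assms(2) by (simp add: power_mult_distrib mult_right_mono)
  finally have "t \<le> (norm y)\<^sup>2" using assms(3) by simp
  then have "(norm x)\<^sup>2 \<le> 0" using assms(1) by linarith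
  then show ?thesis by simp
qed

section \<open>No factorization of degree one\<close>

text \<open>The points \<open>1\<close>, \<open>-1\<close> and \<open>\<i>\<close> of the circle already determine the coefficients.\<close>
lemma trigonometric_coeffs_zero:
  fixes c d e :: complex
  assumes "\<And>z. norm z = 1 \<Longrightarrow> c + z * d + cnj z * e = 0"
  shows "c = 0" "d = 0"
proof -
  have "c + d + e = 0" "c - d - e = 0" "c + \<i> * d - \<i> * e = 0"
    using assms[of 1] assms[of "-1"] assms[of \<i>] by simp_all
  moreover from this have "d + e = 0"  by algebra
  ultimately show "c = 0" by algebra
  with \<open>d + e = 0\<close> \<open>c + \<i> * d - \<i> * e = 0\<close> have "\<i> * (2 * d) = 0" by algebra
  then show "d = 0" by simp
qed

text \<open>Columns 1 and 3 of the stacked matrix of \<open>F\<^sub>0\<close> over \<open>F\<^sub>1\<close> are orthogonal of squared length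
  \<open>h\<close>, so their combinations with coefficients \<open>p\<^sup>2\<close> and \<open>\<plusminus> q\<^sup>2\<close> have squared length \<open>2 h\<^sup>3\<close>. The
  signs are chosen so that the two terms of the inner product with \<open>a\<^sub>2\<close> (for \<open>+\<close>) or with
  \<open>b\<^sub>4\<close> (for \<open>-\<close>) have the same phase. This inner product then has squared modulus
  \<open>2 h\<^sup>4 = h \<cdot> 2 h\<^sup>3\<close>, which saturates the Cauchy--Schwarz inequality.\<close>
lemma column_relations:
  fixes a b :: "4 \<Rightarrow> complex^'n"
  assumes w: "norm w = 1" and \<rho>: "0 < \<rho>" "\<rho> < 1"
    and diag: "\<And>i j. hinner (a i) (a j) + hinner (b i) (b j) = (if i = j then h_fun \<rho> w else 0)"
    and off: "\<And>i j. hinner (a i) (b j) = B_mat \<rho> w $ i $ j"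
  shows "(p_fun \<rho> w)\<^sup>2 *s a 1 + (q_fun \<rho> w)\<^sup>2 *s a 3 = 0"
    and "(p_fun \<rho> w)\<^sup>2 *s b 1 + (- (q_fun \<rho> w)\<^sup>2) *s b 3 = 0"
proof -
  define P where "P = p_fun \<rho> w"
  define Q where "Q = q_fun \<rho> w"
  define H where "H = (norm P)\<^sup>2"
  have w0: "w \<noteq> 0" using w by auto
  have "w \<noteq> of_real \<rho>" using w \<rho> by auto
  then have "0 < H" by (simp add: H_def P_def p_fun_def)
  have nQ: "(norm Q)\<^sup>2 = H"
    using unit_circle_p_q(1)[OF w, of \<rho>] w unfolding H_def P_def Q_def
    by (metis complex_mod_cnj div_by_1 norm_divide)
  have hH: "h_fun \<rho> w = of_real H"
    unfolding H_def P_def complex_norm_square unit_circle_p_q[OF w] by simp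
  have pyth: "(norm (c *s a i + d *s a j))\<^sup>2 + (norm (c *s b i + d *s b j))\<^sup>2
      = ((norm c)\<^sup>2 + (norm d)\<^sup>2) * H" if "i \<noteq> j" for c d i j
  proof -
    have "of_real ((norm (c *s a i + d *s a j))\<^sup>2 + (norm (c *s b i + d *s b j))\<^sup>2)
      = cnj c * c * (hinner (a i) (a i) + hinner (b i) (b i))
        + cnj d * d * (hinner (a j) (a j) + hinner (b j) (b j))
        + cnj c * d * (hinner (a i) (a j) + hinner (b i) (b j))
        + cnj d * c * (hinner (a j) (a i) + hinner (b j) (b i))"
      unfolding of_real_add hinner_self[symmetric] hinner_simps by (simp add: algebra_simps)
    also have "\<dots> = of_real (((norm c)\<^sup>2 + (norm d)\<^sup>2) * H)"
      using that unfolding diag hH of_real_add of_real_mult complex_norm_square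
      by (simp add: algebra_simps)
    finally show ?thesis using of_real_eq_iff by blast
  qed
  have col: "(norm (a i))\<^sup>2 \<le> H" "(norm (b i))\<^sup>2 \<le> H" for i
  proof -
    have "of_real ((norm (a i))\<^sup>2 + (norm (b i))\<^sup>2) = (of_real H :: complex)"
      unfolding of_real_add hinner_self[symmetric] diag by (simp add: hH)
    then have "(norm (a i))\<^sup>2 + (norm (b i))\<^sup>2 = H" using of_real_eq_iff by blast
    moreover have "0 \<le> (norm (a i))\<^sup>2" "0 \<le> (norm (b i))\<^sup>2" by simp_all
    ultimately show "(norm (a i))\<^sup>2 \<le> H" "(norm (b i))\<^sup>2 \<le> H" by linarith+
  qed
  have n4: "(norm (P\<^sup>2))\<^sup>2 = H\<^sup>2" "(norm (Q\<^sup>2))\<^sup>2 = H\<^sup>2"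
    using nQ by (simp_all add: H_def norm_power)
  have total: "(norm (P\<^sup>2 *s a 1 + c *s a 3))\<^sup>2 + (norm (P\<^sup>2 *s b 1 + c *s b 3))\<^sup>2 = 2 * H ^ 3"
    if "norm c = norm (Q\<^sup>2)" for c
    using pyth[of 1 3 "P\<^sup>2" c] n4 that by (simp add: power3_eq_cube power2_eq_square)
  have sq2: "(norm (complex_of_real (sqrt 2)))\<^sup>2 = 2" by simp
  have "hinner (a 2) (P\<^sup>2 *s b 1 + Q\<^sup>2 *s b 3) = 2 * P\<^sup>2 * Q\<^sup>2 / (of_real (sqrt 2) * w)"
    by (simp add: hinner_simps off B_mat_entry P_def Q_def add_divide_distrib[symmetric])
  then have "(norm (hinner (a 2) (P\<^sup>2 *s b 1 + Q\<^sup>2 *s b 3)))\<^sup>2 = H * (2 * H ^ 3)"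
    by (simp only: norm_mult norm_divide w power_mult_distrib power_divide sq2 n4)
      (simp add: power3_eq_cube power2_eq_square)
  then show "(p_fun \<rho> w)\<^sup>2 *s a 1 + (q_fun \<rho> w)\<^sup>2 *s a 3 = 0"
    unfolding P_def[symmetric] Q_def[symmetric]
    using zero_if_cauchy_schwarz_saturated total[of "Q\<^sup>2"] col \<open>0 < H\<close>
    by (metis order_refl)
  have "hinner (P\<^sup>2 *s a 1 + (- Q\<^sup>2) *s a 3) (b 4) =
     (cnj (P\<^sup>2) * P\<^sup>2 + cnj (Q\<^sup>2) * Q\<^sup>2) / (of_real (sqrt 2) * w)"
    by (simp only: hinner_simps off) (simp add: B_mat_entry P_def Q_def add_divide_distrib)
  also have "cnj (P\<^sup>2) * P\<^sup>2 + cnj (Q\<^sup>2) * Q\<^sup>2 = of_real (2 * H\<^sup>2)"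
    using n4 complex_norm_square[of "P\<^sup>2"] complex_norm_square[of "Q\<^sup>2"] by (simp add: mult.commute)
  finally have "(norm (hinner (b 4) (P\<^sup>2 *s a 1 + (- Q\<^sup>2) *s a 3)))\<^sup>2 = H * (2 * H ^ 3)"
    by (subst hinner_commute) (simp add: norm_mult norm_divide w power_mult_distrib power_divide sq2
        power3_eq_cube power2_eq_square)
  then show "(p_fun \<rho> w)\<^sup>2 *s b 1 + (- (q_fun \<rho> w)\<^sup>2) *s b 3 = 0"
    unfolding P_def[symmetric] Q_def[symmetric]
    using zero_if_cauchy_schwarz_saturated total[of "- Q\<^sup>2"] col \<open>0 < H\<close>
    by (metis add.commute norm_minus_cancel order_refl)
qed

text \<open>It suffices to look at the first column: the relations force a double zero at \<open>1 / \<rho>\<close> on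
  each of its entries, whereas the sum of their squared moduli is \<open>h\<close>, which continues to a function
  with a simple zero there.\<close>
lemma deg_z_ge_2:
  fixes F :: "(4, 'n::finite) matrix_poly2"
  assumes \<rho>: "0 < \<rho>" "\<rho> < 1"
    and F: "\<And>z w. norm z = 1 \<Longrightarrow> norm w = 1 \<Longrightarrow>
      P_mat \<rho> z w = ctranspose (eval2 F z w) ** eval2 F z w"
  shows "deg_z F \<ge> 2"
proof (rule ccontr)
  assume "\<not> deg_z F \<ge> 2"
  then have deg: "degree (entry_poly F k i) \<le> 1" for k i
    using degree_entry_poly_le[of F k i] by linarith
  define A where "A = (\<lambda>k i. coeff (entry_poly F k i) 0)"
  define B where "B = (\<lambda>k i. coeff (entry_poly F k i) 1)"
  define a where "a = (\<lambda>w i. \<chi> k. poly (A k i) w)"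
  define b where "b = (\<lambda>w i. \<chi> k. poly (B k i) w)"
  have ev: "eval2 F z w $ k $ i = (a w i + z *s b w i) $ k" for z w k i
    by (simp add: eval2_entry poly_sum_degree_le[OF deg] A_def B_def a_def b_def)
  have gram: "hinner (a w i + z *s b w i) (a w j + z *s b w j) = P_mat \<rho> z w $ i $ j"
    if "norm z = 1" "norm w = 1" for z w i j
    by (simp add: F[OF that] ctranspose_mult_entry ev hinner_def)
  have coeffs: "hinner (a w i) (a w j) + hinner (b w i) (b w j) = (if i = j then h_fun \<rho> w else 0)"
    "hinner (a w i) (b w j) = B_mat \<rho> w $ i $ j" if w: "norm w = 1" for w i j
  proof -
    have "(hinner (a w i) (a w j) + hinner (b w i) (b w j) - (if i = j then h_fun \<rho> w else 0))
        + z * (hinner (a w i) (b w j) - B_mat \<rho> w $ i $ j)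
        + cnj z * (hinner (b w i) (a w j) - cnj (B_mat \<rho> w $ j $ i)) = 0" if z: "norm z = 1" for z
    proof -
      have "z * cnj z = 1" using z by (simp flip: complex_norm_square)
      then have "hinner (a w i + z *s b w i) (a w j + z *s b w j) = 
        hinner (a w i) (a w j) + hinner (b w i) (b w j) + z * hinner (a w i) (b w j)
        + cnj z * hinner (b w i) (a w j)"
        unfolding hinner_simps by algebra
      then show ?thesis
        using gram[OF z w, of i j] unfolding P_mat_entry cnj_unit[OF z] by (simp add: algebra_simps)
    qed
    from trigonometric_coeffs_zero[OF this]
    show "hinner (a w i) (a w j) + hinner (b w i) (b w j) = (if i = j then h_fun \<rho> w else 0)"
      "hinner (a w i) (b w j) = B_mat \<rho> w $ i $ j" by simp_all
  qed
  define p where "p = [:- of_real \<rho>, 1 :: complex:]"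
  define q where "q = [:1, - of_real \<rho> :: complex:]"
  have poly_p_q: "poly p w = p_fun \<rho> w" "poly q w = q_fun \<rho> w" for w
    by (simp_all add: p_def q_def p_fun_def q_fun_def)
  have cop: "coprime (q\<^sup>2) (p\<^sup>2)"
    using coprime_p_q[OF \<rho>] by (simp add: p_def q_def coprime_commute)
  have rel: "p\<^sup>2 * A k 1 = - (q\<^sup>2 * A k 3)" "p\<^sup>2 * B k 1 = q\<^sup>2 * B k 3" for k
  proof -
    have *: "(p_fun \<rho> w)\<^sup>2 * poly (A k 1) w + (q_fun \<rho> w)\<^sup>2 * poly (A k 3) w = 0"
      "(p_fun \<rho> w)\<^sup>2 * poly (B k 1) w - (q_fun \<rho> w)\<^sup>2 * poly (B k 3) w = 0" if "norm w = 1" for w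
      using column_relations[OF that \<rho> coeffs[OF that]]
      by (auto simp: vec_eq_iff a_def b_def)
    show "p\<^sup>2 * A k 1 = - (q\<^sup>2 * A k 3)" "p\<^sup>2 * B k 1 = q\<^sup>2 * B k 3"
      by (rule poly_eqI_unit_circle; use * in \<open>simp add: poly_p_q eq_neg_iff_add_eq_0\<close>)+
  qed
  have dvdA: "q\<^sup>2 dvd A k 1" and dvdB: "q\<^sup>2 dvd B k 1" for k
    using rel[of k] coprime_dvd_mult_right_iff[OF cop] by (metis dvd_minus_iff dvd_triv_left)+
  (* The entries of both halves of the first column, as one family indexed by a disjoint sum. *)
  define C where "C = case_sum (\<lambda>k. A k 1) (\<lambda>k. B k 1)"
  have "w * (\<Sum>s\<in>UNIV. cnj (poly (C s) w) * poly (C s) w) = poly (p * q) w" if w: "norm w = 1" for w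
  proof -
    have "(\<Sum>s\<in>UNIV. cnj (poly (C s) w) * poly (C s) w) = hinner (a w 1) (a w 1) + hinner (b w 1) (b w 1)"
      unfolding UNIV_Plus_UNIV[symmetric]
      by (simp add: sum.Plus C_def hinner_def a_def b_def del: UNIV_Plus_UNIV)
    moreover have "w \<noteq> 0" using w by auto
    ultimately show ?thesis by (simp add: coeffs[OF w] unit_circle_p_q[OF w] poly_p_q)
  qed
  moreover have "q\<^sup>2 dvd C s" for s
    by (cases s) (simp_all add: C_def dvdA dvdB)
  ultimately obtain N where "q\<^sup>2 dvd monom 1 N * (p * q)"
    using dvd_sum_of_squares_unit_circle[of UNIV "q\<^sup>2" C "p * q"] by auto
  moreover have "q \<noteq> 0" by (simp add: q_def)
  ultimately have "q dvd monom 1 N * p"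
    by (simp add: power2_eq_square flip: mult.assoc)
  moreover have "poly q (1 / of_real \<rho>) = 0" using \<rho> by (simp add: q_def)
  ultimately have "poly (monom 1 N * p) (1 / of_real \<rho>) = 0"
    by (meson dvd_trans poly_eq_0_iff_dvd)
  then have "(of_real (\<rho> * \<rho>) :: complex) = of_real 1"
    using \<rho> by (auto simp: poly_monom p_def field_simps)
  then have "\<rho> * \<rho> = 1" using of_real_eq_iff by blast
  moreover have "\<rho> * \<rho> < 1" using \<rho> using mult_strict_mono[of \<rho> 1 \<rho> 1] by simp
  ultimately show False by simp
qed

theorem proposition2p1:
  fixes \<rho> :: real
  assumes "0 < \<rho>" and "\<rho> < 1"
  shows "(\<exists>G :: (4, 2) matrix_poly2.
            deg_z G = 2 \<and>
            (\<forall>z w. eval2 G z w = G_mat \<rho> z w) \<and>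
            (\<forall>z w. norm z = 1 \<and> norm w = 1 \<longrightarrow>
               P_mat \<rho> z w = ctranspose (eval2 G z w) ** eval2 G z w)) \<and>
         (\<forall>z w. norm z = 1 \<and> norm w = 1 \<longrightarrow> psd (P_mat \<rho> z w)) \<and>
         (\<forall>F :: (4, 'n::finite) matrix_poly2.
            (\<forall>z w. norm z = 1 \<and> norm w = 1 \<longrightarrow>
               P_mat \<rho> z w = ctranspose (eval2 F z w) ** eval2 F z w)
            \<longrightarrow> deg_z F \<ge> 2)"
proof (intro conjI allI impI)
  show "\<exists>G :: (4, 2) matrix_poly2.
            deg_z G = 2 \<and>
            (\<forall>z w. eval2 G z w = G_mat \<rho> z w) \<and>
            (\<forall>z w. norm z = 1 \<and> norm w = 1 \<longrightarrow>
               P_mat \<rho> z w = ctranspose (eval2 G z w) ** eval2 G z w)"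
    using deg_G_poly[OF assms(2)] P_mat_eq_gram_G_mat
    by (intro exI[of _ "G_poly \<rho>"]) (simp add: eval2_G_poly)
next
  fix z w :: complex assume "norm z = 1 \<and> norm w = 1"
  then show "psd (P_mat \<rho> z w)" by (simp add: P_mat_eq_gram_G_mat psd_gram)
next
  fix F :: "(4, 'n) matrix_poly2"
  assume "\<forall>z w. norm z = 1 \<and> norm w = 1 \<longrightarrow>
               P_mat \<rho> z w = ctranspose (eval2 F z w) ** eval2 F z w"
  then show "deg_z F \<ge> 2" by (intro deg_z_ge_2[OF assms]) auto
qed

end
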